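(* Let $G$ be a dihedral group and let $R$ be a commutative ring. Then for every subgroup $H \leq G$, $$\mathrm{N}_{\mathrm{U}(RG)}(H) = \mathrm{N}_G(H)\cdot \mathrm{C}_{\mathrm{U}(RG)}(H).$$
   Context: Rings have an identity element $1$, and $R \neq 0$. Groups may be infinite. $RG$ is the group ring of $G$ over $R$ and $\mathrm{U}(RG)$ its group of units; $G$ is regarded as a subgroup of $\mathrm{U}(RG)$. For a group $X$ containing $H$ as a subgroup, $\mathrm{N}_X(H)=\{x\in X : x^{-1}Hx=H\}$ is the normalizer and $\mathrm{C}_X(H)$ the centralizer of $H$ in $X$. *)

theory Defs
  imports "HOL-Algebra.Group_Action" "HOL-Algebra.Generated_Groups" "HOL-Algebra.Ring"
begin

text \<open>
  The group ring of \<open>G\<close> over \<open>R\<close>: a formal sum \<open>\<Sum>\<^sub>g a\<^sub>g g\<close> is represented by its coefficient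
  function \<open>g \<mapsto> a\<^sub>g\<close>, which takes the value zero outside \<open>carrier G\<close> so that equality of formal sums
  is equality of functions. The product is convolution; it suffices to sum over the (finite) support
  of the left factor.
\<close>

definition group_ring ::
  "('r, 'm) ring_scheme \<Rightarrow> ('g, 'n) monoid_scheme \<Rightarrow> ('g \<Rightarrow> 'r) ring"
  where "group_ring R G =
    \<lparr> carrier = {a. (\<forall>g \<in> carrier G. a g \<in> carrier R) \<and> (\<forall>g. g \<notin> carrier G \<longrightarrow> a g = \<zero>\<^bsub>R\<^esub>)
                    \<and> finite {g \<in> carrier G. a g \<noteq> \<zero>\<^bsub>R\<^esub>}},
      mult = (\<lambda>a b x. if x \<in> carrier G
                then (\<Oplus>\<^bsub>R\<^esub>y \<in> {y \<in> carrier G. a y \<noteq> \<zero>\<^bsub>R\<^esub>}. a y \<otimes>\<^bsub>R\<^esub> b (inv\<^bsub>G\<^esub> y \<otimes>\<^bsub>G\<^esub> x))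
                else \<zero>\<^bsub>R\<^esub>),
      one = (\<lambda>x. if x = \<one>\<^bsub>G\<^esub> then \<one>\<^bsub>R\<^esub> else \<zero>\<^bsub>R\<^esub>),
      zero = (\<lambda>x. \<zero>\<^bsub>R\<^esub>),
      add = (\<lambda>a b x. a x \<oplus>\<^bsub>R\<^esub> b x) \<rparr>"

definition group_ring_units ::
  "('r, 'm) ring_scheme \<Rightarrow> ('g, 'n) monoid_scheme \<Rightarrow> ('g \<Rightarrow> 'r) monoid"
  where "group_ring_units R G = units_of (group_ring R G)"

text \<open>
  The embedding of the group into its group ring, sending \<open>g\<close> to the formal sum \<open>1 \<cdot> g\<close>.
\<close>

definition group_ring_elt :: "('r, 'm) ring_scheme \<Rightarrow> 'g \<Rightarrow> 'g \<Rightarrow> 'r"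
  where "group_ring_elt R g = (\<lambda>x. if x = g then \<one>\<^bsub>R\<^esub> else \<zero>\<^bsub>R\<^esub>)"

definition centralizer :: "('a, 'b) monoid_scheme \<Rightarrow> 'a set \<Rightarrow> 'a set"
  where "centralizer X H = {x \<in> carrier X. \<forall>h \<in> H. x \<otimes>\<^bsub>X\<^esub> h = h \<otimes>\<^bsub>X\<^esub> x}"

text \<open>
  Dihedral groups, finite or infinite: the cyclic rotation group generated by \<open>r\<close> may have any order
  \<open>n \<ge> 1\<close> or be infinite. The condition that \<open>s\<close> is not a rotation makes the group of order \<open>2n\<close>
  (isomorphic to the semidirect product of the rotation group by a group of order two acting by
  inversion), also in the degenerate cases \<open>n = 1\<close> (order two) and \<open>n = 2\<close> (Klein four-group).
\<close>

definition dihedral_group :: "('a, 'b) monoid_scheme \<Rightarrow> bool"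
  where "dihedral_group G \<longleftrightarrow> group G \<and>
    (\<exists>r \<in> carrier G. \<exists>s \<in> carrier G.
       generate G {r, s} = carrier G \<and>
       s \<notin> generate G {r} \<and>
       s \<otimes>\<^bsub>G\<^esub> s = \<one>\<^bsub>G\<^esub> \<and>
       s \<otimes>\<^bsub>G\<^esub> r \<otimes>\<^bsub>G\<^esub> inv\<^bsub>G\<^esub> s = inv\<^bsub>G\<^esub> r)"

end

theory Submission
  imports Defs
begin

text \<open>
  A unit \<open>u\<close> normalizing \<open>H\<close> induces by conjugation a homomorphism \<open>\<phi>\<close> from \<open>H\<close> to \<open>H\<close>. If \<open>\<phi>\<close> is
  also conjugation by some \<open>g\<close> in \<open>G\<close>, then \<open>g\<close> normalizes \<open>H\<close>, \<open>g\<inverse> u\<close> centralizes \<open>H\<close>, and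
  \<open>u = g (g\<inverse> u)\<close> is the required factorization (\<open>normalizer_image_eq_mult_centralizer\<close>).

  Whether such a \<open>g\<close> exists is a question about \<open>G\<close> alone, because \<open>\<phi>\<close> maps every \<open>h\<close> to a conjugate
  of \<open>h\<close> in \<open>G\<close> (\<open>conjugate_if_products_in_both_orders\<close>): the element \<open>\<phi> h\<close> is the product of \<open>u h\<close>
  and \<open>u\<inverse>\<close>, and \<open>h\<close> is the product of the same factors in the other order. Since \<open>R\<close> is
  commutative, summing coefficients over one conjugacy class is a trace, so it does not see the
  order of the factors. The sum for \<open>h\<close> over the class of \<open>h\<close> is \<open>1\<close>; as \<open>1 \<noteq> 0\<close> in \<open>R\<close>, the element
  \<open>\<phi> h\<close> has to lie in that class too.

  In a dihedral group, a homomorphism on a subgroup \<open>H\<close> that maps every element to a conjugate is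
  conjugation by a single element (\<open>class_preserving_imp_conjugation\<close>). A rotation is conjugate only
  to itself and its inverse, which makes \<open>\<phi>\<close> the identity or inversion on all rotations in \<open>H\<close>; a
  reflection \<open>t\<close> in \<open>H\<close> goes to \<open>a t a\<inverse>\<close> with \<open>a\<close> a rotation; and \<open>a\<close> or \<open>a t\<close> conjugates
  as \<open>\<phi>\<close> does.
\<close>

section \<open>Class-preserving homomorphisms on subgroups of dihedral groups\<close>

lemma (in group) conj_mult:
  assumes "g \<in> carrier G" "x \<in> carrier G" "y \<in> carrier G"
  shows "g \<otimes> (x \<otimes> y) \<otimes> inv g = (g \<otimes> x \<otimes> inv g) \<otimes> (g \<otimes> y \<otimes> inv g)"
proof -
  have "inv g \<otimes> (g \<otimes> (y \<otimes> inv g)) = y \<otimes> inv g"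
    using assms by (simp flip: m_assoc)
  then show ?thesis
    using assms by (simp add: m_assoc)
qed

lemma (in group) conj_conj:
  assumes "g \<in> carrier G" "h \<in> carrier G" "x \<in> carrier G"
  shows "(g \<otimes> h) \<otimes> x \<otimes> inv (g \<otimes> h) = g \<otimes> (h \<otimes> x \<otimes> inv h) \<otimes> inv g"
  using assms by (simp add: inv_mult_group m_assoc)

lemma (in group) inv_eq_self:
  assumes "s \<in> carrier G" "s \<otimes> s = \<one>"
  shows "inv s = s"
  using assms by (intro inv_equality) auto

text \<open>The elements of \<open>K\<close> that \<open>\<phi>\<close> fixes and those that it inverts form two subgroups covering \<open>K\<close>
  (the second one because \<open>K\<close> is abelian), and a group is not the union of two proper subgroups.\<close>

lemma (in group) id_or_inversion:
  assumes K: "subgroup K G"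
    and comm: "\<And>x y. x \<in> K \<Longrightarrow> y \<in> K \<Longrightarrow> x \<otimes> y = y \<otimes> x"
    and mult: "\<And>x y. x \<in> K \<Longrightarrow> y \<in> K \<Longrightarrow> \<phi> (x \<otimes> y) = \<phi> x \<otimes> \<phi> y"
    and val: "\<And>x. x \<in> K \<Longrightarrow> \<phi> x = x \<or> \<phi> x = inv x"
  shows "(\<forall>x\<in>K. \<phi> x = x) \<or> (\<forall>x\<in>K. \<phi> x = inv x)"
proof (rule ccontr)
  assume "\<not> ?thesis"
  then obtain x y where x: "x \<in> K" "\<phi> x \<noteq> x" and y: "y \<in> K" "\<phi> y \<noteq> inv y" by blast
  have \<phi>x: "\<phi> x = inv x" and \<phi>y: "\<phi> y = y"
    using val x y by blast+
  have carr: "x \<in> carrier G" "y \<in> carrier G"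
    using x y subgroup.mem_carrier[OF K] by auto
  have xy: "x \<otimes> y \<in> K"
    using x y subgroup.m_closed[OF K] by blast
  have eq: "\<phi> (x \<otimes> y) = inv x \<otimes> y"
    using mult[OF x(1) y(1)] \<phi>x \<phi>y by simp
  from val[OF xy] show False
  proof
    assume "\<phi> (x \<otimes> y) = x \<otimes> y"
    then have "inv x = x"
      using eq carr by simp
    then show False using x \<phi>x by simp
  next
    assume "\<phi> (x \<otimes> y) = inv (x \<otimes> y)"
    also have "\<dots> = inv x \<otimes> inv y"
      using comm[OF x(1) y(1)] carr by (simp add: inv_mult_group)
    finally have "y = inv y"
      using eq carr by simp
    then show False using y \<phi>y by simp
  qed
qed

text \<open>Elements of \<open>A\<close> centralize \<open>A\<close>, and a further factor \<open>t\<close> adds an inversion on \<open>A\<close>. Moreover \<open>t\<close>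
  commutes with itself, so conjugating \<open>t\<close> by \<open>a \<otimes> t\<close> is the same as conjugating it by \<open>a\<close>.\<close>

lemma (in group) conj_in_extension_by_inversion:
  assumes A: "subgroup A G"
    and comm: "\<And>a b. a \<in> A \<Longrightarrow> b \<in> A \<Longrightarrow> a \<otimes> b = b \<otimes> a"
    and t: "t \<in> carrier G"
    and inverts: "\<And>a. a \<in> A \<Longrightarrow> t \<otimes> a \<otimes> inv t = inv a"
    and cover: "\<And>x. x \<in> carrier G \<Longrightarrow> x \<in> A \<or> (\<exists>a\<in>A. x = a \<otimes> t)"
    and g: "g \<in> carrier G"
  shows conj_abelian_part: "k \<in> A \<Longrightarrow> g \<otimes> k \<otimes> inv g = k \<or> g \<otimes> k \<otimes> inv g = inv k"
    and conj_reflection: "\<exists>a\<in>A. g \<otimes> t \<otimes> inv g = a \<otimes> t \<otimes> inv a"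
proof -
  have Ac: "a \<in> carrier G" if "a \<in> A" for a
    using that subgroup.mem_carrier[OF A] by blast
  have fix_A: "a \<otimes> k \<otimes> inv a = k" if "a \<in> A" "k \<in> A" for a k
    using that comm[OF that] Ac by (simp add: m_assoc)
  show "g \<otimes> k \<otimes> inv g = k \<or> g \<otimes> k \<otimes> inv g = inv k" if k: "k \<in> A"
    using cover[OF g]
  proof
    assume "g \<in> A"
    then show ?thesis using fix_A k by blast
  next
    assume "\<exists>a\<in>A. g = a \<otimes> t"
    then obtain a where a: "a \<in> A" "g = a \<otimes> t" by blast
    have "g \<otimes> k \<otimes> inv g = a \<otimes> inv k \<otimes> inv a"
      using a k t Ac inverts conj_conj by simp
    also have "\<dots> = inv k"
      using fix_A a k subgroup.m_inv_closed[OF A] by blast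
    finally show ?thesis by blast
  qed
  show "\<exists>a\<in>A. g \<otimes> t \<otimes> inv g = a \<otimes> t \<otimes> inv a"
    using cover[OF g]
  proof
    assume "g \<in> A"
    then show ?thesis by blast
  next
    assume "\<exists>a\<in>A. g = a \<otimes> t"
    then obtain a where a: "a \<in> A" "g = a \<otimes> t" by blast
    have "g \<otimes> t \<otimes> inv g = a \<otimes> t \<otimes> inv a"
      using a t Ac conj_conj[of a t t] by (simp add: m_assoc)
    then show ?thesis using a by blast
  qed
qed

text \<open>On \<open>H \<inter> A\<close> the map \<open>\<phi>\<close> is the identity or inversion, conjugation by \<open>\<one>\<close> or \<open>s\<close>. If \<open>H\<close> also
  contains a reflection \<open>t\<close>, then \<open>H\<close> is generated by \<open>H \<inter> A\<close> and \<open>t\<close>, and \<open>\<phi> t\<close> is a conjugate of \<open>t\<close>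
  by some \<open>a\<close> in \<open>A\<close>. Conjugation by \<open>a\<close> and by \<open>a \<otimes> t\<close> agree at \<open>t\<close>, while on \<open>A\<close> they are the
  identity and inversion, so one of them is \<open>\<phi>\<close>.\<close>

lemma (in group) class_preserving_imp_conjugation:
  assumes A: "subgroup A G"
    and comm: "\<And>a b. a \<in> A \<Longrightarrow> b \<in> A \<Longrightarrow> a \<otimes> b = b \<otimes> a"
    and s: "s \<in> carrier G"
    and inverts: "\<And>a. a \<in> A \<Longrightarrow> s \<otimes> a \<otimes> inv s = inv a"
    and cover: "\<And>x. x \<in> carrier G \<Longrightarrow> x \<in> A \<or> (\<exists>a\<in>A. x = a \<otimes> s)"
    and H: "subgroup H G"
    and mult: "\<And>x y. x \<in> H \<Longrightarrow> y \<in> H \<Longrightarrow> \<phi> (x \<otimes> y) = \<phi> x \<otimes> \<phi> y"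
    and class_pres: "\<And>x. x \<in> H \<Longrightarrow> \<exists>g\<in>carrier G. \<phi> x = g \<otimes> x \<otimes> inv g"
  shows "\<exists>g\<in>carrier G. \<forall>x\<in>H. \<phi> x = g \<otimes> x \<otimes> inv g"
proof -
  have Ac: "a \<in> carrier G" if "a \<in> A" for a
    using that subgroup.mem_carrier[OF A] by blast
  have Hc: "h \<in> carrier G" if "h \<in> H" for h
    using that subgroup.mem_carrier[OF H] by blast
  have fix_A: "a \<otimes> k \<otimes> inv a = k" if "a \<in> A" "k \<in> A" for a k
    using that comm[OF that] Ac by (simp add: m_assoc)
  have K: "subgroup (H \<inter> A) G"
    using H A by (rule subgroups_Inter_pair)
  have sign: "(\<forall>x\<in>H \<inter> A. \<phi> x = x) \<or> (\<forall>x\<in>H \<inter> A. \<phi> x = inv x)"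
  proof (rule id_or_inversion[OF K])
    fix x assume "x \<in> H \<inter> A"
    then obtain g where "g \<in> carrier G" "\<phi> x = g \<otimes> x \<otimes> inv g" "x \<in> A"
      using class_pres by blast
    then show "\<phi> x = x \<or> \<phi> x = inv x"
      using conj_abelian_part[OF A comm s inverts cover] by metis
  qed (use comm mult in blast)+
  show ?thesis
  proof (cases "H \<subseteq> A")
    case True
    then have HA: "H \<inter> A = H" by blast
    from sign[unfolded HA] show ?thesis
    proof
      assume "\<forall>x\<in>H. \<phi> x = x"
      then show ?thesis using Hc by (intro bexI[of _ \<one>]) auto
    next
      assume "\<forall>x\<in>H. \<phi> x = inv x"
      then show ?thesis using s inverts True by (intro bexI[of _ s]) auto
    qed
  next
    case False
    then obtain t where t: "t \<in> H" "t \<notin> A" by blast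
    have tc: "t \<in> carrier G" using t Hc by blast
    obtain c where c: "c \<in> A" "t = c \<otimes> s"
      using cover[OF tc] t by blast
    \<comment> \<open>Any reflection can take the place of \<open>s\<close>; with \<open>t\<close>, the factor \<open>t\<close> in
      \<open>x = k \<otimes> t\<close> belongs to \<open>H\<close>, and hence so does \<open>k\<close>.\<close>
    have inverts_t: "t \<otimes> a \<otimes> inv t = inv a" if "a \<in> A" for a
      using conj_conj[of c s a] fix_A[of c "inv a"] subgroup.m_inv_closed[OF A that] c that s Ac inverts
      by simp
    have quot: "x \<otimes> inv t \<in> A" if x: "x \<in> carrier G" "x \<notin> A" for x
    proof -
      obtain b where b: "b \<in> A" "x = b \<otimes> s"
        using cover x by blast
      have "x \<otimes> inv t = b \<otimes> inv c"
        using b c s Ac by (simp add: inv_mult_group m_assoc inv_solve_left' flip: m_assoc[of s "inv s"])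
      then show ?thesis
        using b c A subgroup.m_closed subgroup.m_inv_closed by metis
    qed
    have cover_t: "x \<in> A \<or> (\<exists>a\<in>A. x = a \<otimes> t)" if "x \<in> carrier G" for x
    proof -
      have "x = x \<otimes> inv t \<otimes> t"
        using that tc by (simp add: m_assoc)
      then show ?thesis
        using quot that by blast
    qed
    obtain g where g: "g \<in> carrier G" "\<phi> t = g \<otimes> t \<otimes> inv g"
      using class_pres t by blast
    obtain a where a: "a \<in> A" "\<phi> t = a \<otimes> t \<otimes> inv a"
      using conj_reflection[OF A comm tc inverts_t cover_t g(1)] g(2) by auto
    obtain q where q: "q \<in> carrier G" "\<phi> t = q \<otimes> t \<otimes> inv q"
      "\<And>x. x \<in> H \<inter> A \<Longrightarrow> \<phi> x = q \<otimes> x \<otimes> inv q"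
      using sign
    proof
      assume "\<forall>x\<in>H \<inter> A. \<phi> x = x"
      then show thesis
        using that[of a] a Ac fix_A by auto
    next
      assume inv: "\<forall>x\<in>H \<inter> A. \<phi> x = inv x"
      have "a \<otimes> t \<otimes> t \<otimes> inv (a \<otimes> t) = a \<otimes> t \<otimes> inv a"
        using a tc Ac conj_conj[of a t t] by (simp add: m_assoc)
      moreover have "a \<otimes> t \<otimes> x \<otimes> inv (a \<otimes> t) = inv x" if "x \<in> A" for x
        using conj_conj[of a t x] fix_A[of a "inv x"] subgroup.m_inv_closed[OF A that]
          a tc Ac inverts_t that by simp
      ultimately show thesis
        using that[of "a \<otimes> t"] a inv tc Ac by auto
    qed
    have "\<phi> x = q \<otimes> x \<otimes> inv q" if x: "x \<in> H" for x
    proof (cases "x \<in> A")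
      case True
      then show ?thesis using q x by blast
    next
      case False
      define k where "k = x \<otimes> inv t"
      have kK: "k \<in> H \<inter> A"
        using quot False x t Hc H unfolding k_def
        by (simp add: subgroup.m_closed subgroup.m_inv_closed)
      have xk: "x = k \<otimes> t"
        unfolding k_def using x tc Hc by (simp add: m_assoc)
      have "\<phi> x = \<phi> k \<otimes> \<phi> t"
        using mult kK t xk by blast
      also have "\<dots> = (q \<otimes> k \<otimes> inv q) \<otimes> (q \<otimes> t \<otimes> inv q)"
        using q kK by simp
      also have "\<dots> = q \<otimes> x \<otimes> inv q"
        using conj_mult[of q k t] q kK tc Hc xk by auto
      finally show ?thesis .
    qed
    then show ?thesis using q by blast
  qed
qed

text \<open>The abelian subgroup \<open>A\<close> consists of the rotations, the powers of \<open>r\<close>. The union of \<open>A\<close> and its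
  coset of \<open>s\<close> is closed under products since moving \<open>s\<close> past a rotation only inverts the rotation.\<close>

lemma dihedral_group_decomposition:
  fixes G (structure)
  assumes "dihedral_group G"
  obtains A s where "subgroup A G" "s \<in> carrier G"
    "\<And>a b. a \<in> A \<Longrightarrow> b \<in> A \<Longrightarrow> a \<otimes> b = b \<otimes> a"
    "\<And>a. a \<in> A \<Longrightarrow> s \<otimes> a \<otimes> inv s = inv a"
    "\<And>x. x \<in> carrier G \<Longrightarrow> x \<in> A \<or> (\<exists>a\<in>A. x = a \<otimes> s)"
proof -
  obtain r s where r: "r \<in> carrier G" and s: "s \<in> carrier G"
    and gen: "generate G {r, s} = carrier G" and ss: "s \<otimes> s = \<one>"
    and sr: "s \<otimes> r \<otimes> inv s = inv r" and "group G"
    using assms unfolding dihedral_group_def by blast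
  interpret group G by fact
  let ?A = "generate G {r}"
  have A: "subgroup ?A G"
    using generate_is_subgroup r by simp
  have Ac: "a \<in> carrier G" if "a \<in> ?A" for a
    using that subgroup.mem_carrier[OF A] by blast
  have comm: "a \<otimes> b = b \<otimes> a" if "a \<in> ?A" "b \<in> ?A" for a b
    using that r unfolding generate_pow[OF r] by (auto simp: int_pow_mult[symmetric] add.commute)
  have inverts: "s \<otimes> a \<otimes> inv s = inv a" if "a \<in> ?A" for a
    using that
  proof induction
    case one
    then show ?case using s by simp
  next
    case (incl h)
    then show ?case using sr by simp
  next
    case (inv h)
    then show ?case
      using arg_cong[OF sr, of "m_inv G"] r s by (simp add: inv_mult_group m_assoc)
  next
    case (eng a b)
    then have "s \<otimes> (a \<otimes> b) \<otimes> inv s = inv a \<otimes> inv b"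
      using conj_mult s Ac by simp
    also have "\<dots> = inv (b \<otimes> a)"
      using eng Ac by (simp add: inv_mult_group)
    also have "b \<otimes> a = a \<otimes> b"
      using eng comm by blast
    finally show ?case .
  qed
  have inv_s: "inv s = s"
    using s ss by (rule inv_eq_self)
  have sAs: "s \<otimes> a \<otimes> s \<in> ?A" if "a \<in> ?A" for a
    using inverts[OF that] inv_s subgroup.m_inv_closed[OF A that] by simp
  have absorb: "y \<otimes> s \<otimes> s = y" "s \<otimes> (s \<otimes> y) = y" if "y \<in> carrier G" for y
    using that s ss by (simp add: m_assoc, simp add: ss flip: m_assoc)
  \<comment> \<open>As \<open>s\<close> is an involution, \<open>x \<otimes> s \<in> A\<close> says that \<open>x\<close> lies in the coset of \<open>s\<close>.\<close>
  have gen_cover: "x \<in> carrier G \<and> (x \<in> ?A \<or> x \<otimes> s \<in> ?A)" if "x \<in> generate G {r, s}" for x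
    using that
  proof induction
    case one
    then show ?case using generate.one by auto
  next
    case (incl h)
    then show ?case using r s ss by (auto intro: generate.one generate.incl)
  next
    case (inv h)
    then show ?case using r s ss inv_s by (auto intro: generate.one generate.inv)
  next
    case (eng x y)
    have xc: "x \<in> carrier G" and yc: "y \<in> carrier G" using eng by auto
    have eqs: "x \<otimes> y \<otimes> s = x \<otimes> (y \<otimes> s)" "x \<otimes> y = (x \<otimes> s) \<otimes> (s \<otimes> (y \<otimes> s) \<otimes> s)"
      "x \<otimes> y \<otimes> s = (x \<otimes> s) \<otimes> (s \<otimes> y \<otimes> s)"
      using xc yc s by (simp_all add: m_assoc absorb ss)
    have "x \<otimes> y \<in> ?A \<or> x \<otimes> y \<otimes> s \<in> ?A"
      using eng.IH generate.eng sAs eqs by metis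
    then show ?case using xc yc by simp
  qed
  have cover: "x \<in> ?A \<or> (\<exists>a\<in>?A. x = a \<otimes> s)" if "x \<in> carrier G" for x
    using gen_cover[of x] absorb(1)[OF that] that gen by metis
  show thesis
    by (rule that[OF A s comm inverts cover])
qed

section \<open>Normalizers of embedded subgroups\<close>

lemma (in group) normalizer_eq:
  assumes "H \<subseteq> carrier G"
  shows "normalizer G H = {g \<in> carrier G. (\<lambda>h. g \<otimes> h \<otimes> inv g) ` H = H}"
  using assms by (auto simp: normalizer_def stabilizer_def l_coset_def r_coset_def)

text \<open>If \<open>u\<close> acts on the image of \<open>H\<close> as \<open>g\<close> does, dividing \<open>u\<close> by \<open>e g\<close> leaves an element that acts
  trivially; and \<open>g\<close> normalizes \<open>H\<close> itself, not only its image, because \<open>e\<close> is injective.\<close>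

lemma normalizer_image_eq_mult_centralizer:
  fixes G (structure) and X
  assumes "group G" and "group X"
    and e: "e \<in> hom G X" and inj: "inj_on e (carrier G)"
    and H: "H \<subseteq> carrier G"
    and realized: "\<And>u. u \<in> normalizer X (e ` H) \<Longrightarrow>
      \<exists>g\<in>carrier G. \<forall>h\<in>H. u \<otimes>\<^bsub>X\<^esub> e h \<otimes>\<^bsub>X\<^esub> inv\<^bsub>X\<^esub> u = e (g \<otimes> h \<otimes> inv g)"
  shows "normalizer X (e ` H) = e ` normalizer G H <#>\<^bsub>X\<^esub> centralizer X (e ` H)"
proof -
  interpret G: group G by fact
  interpret X: group X by fact
  interpret e: group_hom G X e using e by unfold_locales
  have eH: "e ` H \<subseteq> carrier X" using H by auto
  have conj_e: "e (g \<otimes> h \<otimes> inv g) = e g \<otimes>\<^bsub>X\<^esub> e h \<otimes>\<^bsub>X\<^esub> inv\<^bsub>X\<^esub> (e g)"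
    if "g \<in> carrier G" "h \<in> H" for g h
    using that H by (simp add: subset_iff)
  have N_iff: "e g \<in> normalizer X (e ` H) \<longleftrightarrow> g \<in> normalizer G H" if g: "g \<in> carrier G" for g
  proof -
    have "(\<lambda>x. e g \<otimes>\<^bsub>X\<^esub> x \<otimes>\<^bsub>X\<^esub> inv\<^bsub>X\<^esub> (e g)) ` e ` H = e ` (\<lambda>h. g \<otimes> h \<otimes> inv g) ` H"
      using conj_e[OF g] by (simp add: image_image)
    moreover have "(\<lambda>h. g \<otimes> h \<otimes> inv g) ` H \<subseteq> carrier G" using g H by auto
    ultimately show ?thesis
      using inj_on_image_eq_iff[OF inj] H g
      by (simp add: X.normalizer_eq[OF eH] G.normalizer_eq[OF H])
  qed
  have NX: "subgroup (normalizer X (e ` H)) X"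
    using X.normalizer_imp_subgroup[OF eH] .
  have C_conj: "c \<in> centralizer X (e ` H) \<longleftrightarrow>
      c \<in> carrier X \<and> (\<forall>h\<in>H. c \<otimes>\<^bsub>X\<^esub> e h \<otimes>\<^bsub>X\<^esub> inv\<^bsub>X\<^esub> c = e h)" for c
    using H by (auto simp: centralizer_def subset_iff X.inv_solve_right')
  show ?thesis
  proof (intro equalityI subsetI)
    fix u assume u: "u \<in> normalizer X (e ` H)"
    then have uc: "u \<in> carrier X" using subgroup.mem_carrier[OF NX] by blast
    obtain g where g: "g \<in> carrier G"
      and eq: "\<And>h. h \<in> H \<Longrightarrow> u \<otimes>\<^bsub>X\<^esub> e h \<otimes>\<^bsub>X\<^esub> inv\<^bsub>X\<^esub> u = e (g \<otimes> h \<otimes> inv g)"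
      using realized[OF u] by blast
    have "(\<lambda>x. e g \<otimes>\<^bsub>X\<^esub> x \<otimes>\<^bsub>X\<^esub> inv\<^bsub>X\<^esub> (e g)) ` e ` H = (\<lambda>x. u \<otimes>\<^bsub>X\<^esub> x \<otimes>\<^bsub>X\<^esub> inv\<^bsub>X\<^esub> u) ` e ` H"
      using eq conj_e[OF g] by (simp add: image_image)
    then have "e g \<in> normalizer X (e ` H)"
      using u g by (simp add: X.normalizer_eq[OF eH])
    then have gN: "g \<in> normalizer G H" using N_iff g by blast
    define c where "c = inv\<^bsub>X\<^esub> (e g) \<otimes>\<^bsub>X\<^esub> u"
    have cc: "c \<in> carrier X" and u_eq: "u = e g \<otimes>\<^bsub>X\<^esub> c"
      using uc g by (simp_all add: c_def flip: X.m_assoc)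
    have "c \<otimes>\<^bsub>X\<^esub> e h \<otimes>\<^bsub>X\<^esub> inv\<^bsub>X\<^esub> c = e h" if h: "h \<in> H" for h
    proof -
      have hc: "e h \<in> carrier X" using h H by auto
      have "c \<otimes>\<^bsub>X\<^esub> e h \<otimes>\<^bsub>X\<^esub> inv\<^bsub>X\<^esub> c
          = inv\<^bsub>X\<^esub> (e g) \<otimes>\<^bsub>X\<^esub> (u \<otimes>\<^bsub>X\<^esub> e h \<otimes>\<^bsub>X\<^esub> inv\<^bsub>X\<^esub> u) \<otimes>\<^bsub>X\<^esub> inv\<^bsub>X\<^esub> (inv\<^bsub>X\<^esub> (e g))"
        unfolding c_def using uc g hc by (intro X.conj_conj) auto
      also have "u \<otimes>\<^bsub>X\<^esub> e h \<otimes>\<^bsub>X\<^esub> inv\<^bsub>X\<^esub> u = e g \<otimes>\<^bsub>X\<^esub> e h \<otimes>\<^bsub>X\<^esub> inv\<^bsub>X\<^esub> (e g)"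
        using eq[OF h] conj_e[OF g h] by simp
      also have "inv\<^bsub>X\<^esub> (e g) \<otimes>\<^bsub>X\<^esub> (e g \<otimes>\<^bsub>X\<^esub> e h \<otimes>\<^bsub>X\<^esub> inv\<^bsub>X\<^esub> (e g)) \<otimes>\<^bsub>X\<^esub> inv\<^bsub>X\<^esub> (inv\<^bsub>X\<^esub> (e g)) = e h"
        using X.conj_conj[of "inv\<^bsub>X\<^esub> (e g)" "e g" "e h"] g hc by simp
      finally show ?thesis .
    qed
    then have "c \<in> centralizer X (e ` H)" using cc C_conj by blast
    then show "u \<in> e ` normalizer G H <#>\<^bsub>X\<^esub> centralizer X (e ` H)"
      using gN u_eq unfolding set_mult_def by blast
  next
    fix u assume "u \<in> e ` normalizer G H <#>\<^bsub>X\<^esub> centralizer X (e ` H)"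
    then obtain g c where g: "g \<in> normalizer G H" and c: "c \<in> centralizer X (e ` H)"
      and u: "u = e g \<otimes>\<^bsub>X\<^esub> c"
      unfolding set_mult_def by blast
    have gc: "g \<in> carrier G" using g by (simp add: G.normalizer_eq[OF H])
    have "c \<in> normalizer X (e ` H)"
      using c C_conj by (simp add: X.normalizer_eq[OF eH] image_image)
    then show "u \<in> normalizer X (e ` H)"
      using g N_iff gc u subgroup.m_closed[OF NX] by blast
  qed
qed

section \<open>The group ring through its linear functionals\<close>

lemma (in abelian_monoid) finsum_swap:
  assumes "finite A" "finite B" "\<And>x y. x \<in> A \<Longrightarrow> y \<in> B \<Longrightarrow> f x y \<in> carrier G"
  shows "(\<Oplus>x\<in>A. \<Oplus>y\<in>B. f x y) = (\<Oplus>y\<in>B. \<Oplus>x\<in>A. f x y)"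
  using assms(1,3)
proof (induction A)
  case empty
  then show ?case by simp
next
  case (insert a A)
  have "(\<Oplus>x\<in>insert a A. \<Oplus>y\<in>B. f x y) = (\<Oplus>y\<in>B. f a y) \<oplus> (\<Oplus>y\<in>B. \<Oplus>x\<in>A. f x y)"
    using insert by (subst finsum_insert) (auto intro!: finsum_closed)
  also have "\<dots> = (\<Oplus>y\<in>B. f a y \<oplus> (\<Oplus>x\<in>A. f x y))"
    using insert by (subst finsum_addf) (auto intro!: finsum_closed)
  also have "\<dots> = (\<Oplus>y\<in>B. \<Oplus>x\<in>insert a A. f x y)"
    using insert by (intro finsum_cong') (auto intro!: finsum_closed)
  finally show ?case .
qed

locale group_ring_context = cring R + G: group G for R (structure) and G (structure)
begin

abbreviation RG where "RG \<equiv> group_ring R G"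

definition support :: "('c \<Rightarrow> 'a) \<Rightarrow> 'c set"
  where "support a = {x \<in> carrier G. a x \<noteq> \<zero>}"

text \<open>The value at \<open>a\<close> of the \<open>R\<close>-linear extension of \<open>f\<close> to the group ring. Products become nested
  pairings (\<open>pairing_mult\<close>), in which each support is summed over freely; this avoids substitutions
  in convolution sums, and it turns both associativity and the trace property of class functions
  into statements about the argument of \<open>f\<close>.\<close>

definition pairing :: "('c \<Rightarrow> 'a) \<Rightarrow> ('c \<Rightarrow> 'a) \<Rightarrow> 'a"
  where "pairing f a = (\<Oplus>x\<in>support a. f x \<otimes> a x)"

lemma carrier_RG: "a \<in> carrier RG \<longleftrightarrow>
    (\<forall>g. a g \<in> carrier R) \<and> (\<forall>g. g \<notin> carrier G \<longrightarrow> a g = \<zero>) \<and> finite (support a)"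
  by (auto simp: group_ring_def support_def)

lemma RG_coeff: "a \<in> carrier RG \<Longrightarrow> a g \<in> carrier R"
  by (simp add: carrier_RG)

lemma finite_support [simp, intro]: "a \<in> carrier RG \<Longrightarrow> finite (support a)"
  by (simp add: carrier_RG)

lemma support_carrier: "x \<in> support a \<Longrightarrow> x \<in> carrier G"
  by (simp add: support_def)

lemma mult_RG: "(a \<otimes>\<^bsub>RG\<^esub> b) x =
    (if x \<in> carrier G then (\<Oplus>y\<in>support a. a y \<otimes> b (inv\<^bsub>G\<^esub> y \<otimes>\<^bsub>G\<^esub> x)) else \<zero>)"
  by (simp add: group_ring_def support_def)

lemma pairing_superset:
  assumes "a \<in> carrier RG" "finite S" "support a \<subseteq> S" "S \<subseteq> carrier G"
    "f \<in> carrier G \<rightarrow> carrier R"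
  shows "pairing f a = (\<Oplus>x\<in>S. f x \<otimes> a x)"
  unfolding pairing_def using assms RG_coeff[OF assms(1)]
  by (intro add.finprod_mono_neutral_cong_left) (auto simp: support_def Pi_iff subset_iff)

lemma pairing_closed [simp, intro]:
  assumes "a \<in> carrier RG" "f \<in> carrier G \<rightarrow> carrier R"
  shows "pairing f a \<in> carrier R"
  unfolding pairing_def using assms RG_coeff[OF assms(1)] by (intro finsum_closed) (auto dest: support_carrier)

lemma pairing_cong:
  assumes "a \<in> carrier RG" "g \<in> carrier G \<rightarrow> carrier R" "\<And>x. x \<in> carrier G \<Longrightarrow> f x = g x"
  shows "pairing f a = pairing g a"
  unfolding pairing_def using assms RG_coeff[OF assms(1)]
  by (intro finsum_cong') (auto intro!: m_closed funcset_mem[OF assms(2)] dest: support_carrier)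

lemma pairing_elt:
  assumes "g \<in> carrier G" "f \<in> carrier G \<rightarrow> carrier R"
  shows "group_ring_elt R g \<in> carrier RG" and "pairing f (group_ring_elt R g) = f g"
proof -
  have fin: "finite (support (group_ring_elt R g))"
  proof (rule finite_subset)
    show "support (group_ring_elt R g) \<subseteq> {g}"
      by (auto simp: support_def group_ring_elt_def)
  qed simp
  then show closed: "group_ring_elt R g \<in> carrier RG"
    using assms unfolding carrier_RG by (simp add: group_ring_elt_def)
  have "pairing f (group_ring_elt R g) = (\<Oplus>x\<in>{g}. f x \<otimes> group_ring_elt R g x)"
    using assms closed by (intro pairing_superset) (auto simp: support_def group_ring_elt_def)
  also have "\<dots> = f g"
    using assms by (simp add: group_ring_elt_def Pi_iff)
  finally show "pairing f (group_ring_elt R g) = f g" .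
qed

lemma elt_closed: "g \<in> carrier G \<Longrightarrow> group_ring_elt R g \<in> carrier RG"
  by (rule pairing_elt(1)[of g "\<lambda>_. \<zero>"]) auto

text \<open>Indicator functions of single elements recover the coefficients, so the functionals separate the
  points of the group ring.\<close>

lemma RG_eqI:
  assumes "a \<in> carrier RG" "b \<in> carrier RG"
    "\<And>f. f \<in> carrier G \<rightarrow> carrier R \<Longrightarrow> pairing f a = pairing f b"
  shows "a = b"
proof
  fix x
  have coeff: "pairing (\<lambda>y. if y = x then \<one> else \<zero>) c = c x"
    if c: "c \<in> carrier RG" and x: "x \<in> carrier G" for c
  proof -
    note [simp] = RG_coeff[OF c]
    have "pairing (\<lambda>y. if y = x then \<one> else \<zero>) c
        = (\<Oplus>y\<in>insert x (support c). (if y = x then \<one> else \<zero>) \<otimes> c y)"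
      using c x by (intro pairing_superset) (auto dest: support_carrier)
    also have "\<dots> = (\<Oplus>y\<in>insert x (support c). if x = y then c y else \<zero>)"
      using c by (intro finsum_cong') auto
    also have "\<dots> = c x"
      using c by (intro finsum_singleton) auto
    finally show ?thesis .
  qed
  show "a x = b x"
  proof (cases "x \<in> carrier G")
    case True
    then show ?thesis
      using coeff[of a] coeff[of b] assms(1,2) assms(3)[of "\<lambda>y. if y = x then \<one> else \<zero>"] by auto
  next
    case False
    then show ?thesis using assms by (simp add: carrier_RG)
  qed
qed

text \<open>The convolution sums \<open>a y\<close> times \<open>b z\<close> over the pairs with \<open>y z = x\<close>, so weighting it by \<open>f x\<close> and
  summing over \<open>x\<close> gives the sum over all pairs weighted by \<open>f (y z)\<close>.\<close>

lemma pairing_mult: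
  assumes a: "a \<in> carrier RG" and b: "b \<in> carrier RG"
  shows mult_closed: "a \<otimes>\<^bsub>RG\<^esub> b \<in> carrier RG"
    and "f \<in> carrier G \<rightarrow> carrier R \<Longrightarrow>
      pairing f (a \<otimes>\<^bsub>RG\<^esub> b) = pairing (\<lambda>y. pairing (\<lambda>z. f (y \<otimes>\<^bsub>G\<^esub> z)) b) a"
proof -
  note [simp] = RG_coeff[OF a] RG_coeff[OF b]
  \<comment> \<open>A finite set containing the support of the product, independent of cancellations in it.\<close>
  define S where "S = (\<lambda>(y, z). y \<otimes>\<^bsub>G\<^esub> z) ` (support a \<times> support b)"
  have S: "finite S" "S \<subseteq> carrier G"
    using a b by (auto simp: S_def dest: support_carrier)
  have outside: "b (inv\<^bsub>G\<^esub> y \<otimes>\<^bsub>G\<^esub> x) = \<zero>"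
    if y: "y \<in> support a" and x: "x \<in> carrier G" "x \<notin> (\<lambda>z. y \<otimes>\<^bsub>G\<^esub> z) ` support b" for x y
  proof (rule ccontr)
    assume "b (inv\<^bsub>G\<^esub> y \<otimes>\<^bsub>G\<^esub> x) \<noteq> \<zero>"
    then have "inv\<^bsub>G\<^esub> y \<otimes>\<^bsub>G\<^esub> x \<in> support b"
      using y x by (simp add: support_def)
    moreover have "x = y \<otimes>\<^bsub>G\<^esub> (inv\<^bsub>G\<^esub> y \<otimes>\<^bsub>G\<^esub> x)"
      using y x by (simp add: support_carrier flip: G.m_assoc)
    ultimately show False using x by blast
  qed
  have supp: "support (a \<otimes>\<^bsub>RG\<^esub> b) \<subseteq> S"
  proof
    fix x assume x: "x \<in> support (a \<otimes>\<^bsub>RG\<^esub> b)"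
    then have xc: "x \<in> carrier G" by (rule support_carrier)
    show "x \<in> S"
    proof (rule ccontr)
      assume "x \<notin> S"
      then have "x \<notin> (\<lambda>z. y \<otimes>\<^bsub>G\<^esub> z) ` support b" if "y \<in> support a" for y
        using that by (force simp: S_def)
      then have "a y \<otimes> b (inv\<^bsub>G\<^esub> y \<otimes>\<^bsub>G\<^esub> x) = \<zero>" if "y \<in> support a" for y
        using outside[OF that xc] that by simp
      then have "(a \<otimes>\<^bsub>RG\<^esub> b) x = \<zero>"
        using xc by (simp add: mult_RG add.finprod_one_eqI)
      then show False using x by (simp add: support_def)
    qed
  qed
  have "finite (support (a \<otimes>\<^bsub>RG\<^esub> b))"
    using S supp finite_subset by blast
  moreover have "(a \<otimes>\<^bsub>RG\<^esub> b) x \<in> carrier R" for x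
    unfolding mult_RG by (simp add: Pi_iff)
  ultimately show closed: "a \<otimes>\<^bsub>RG\<^esub> b \<in> carrier RG"
    unfolding carrier_RG by (simp add: mult_RG)
  assume f: "f \<in> carrier G \<rightarrow> carrier R"
  have fc: "f x \<in> carrier R" if "x \<in> carrier G" for x using f that by blast
  note [simp] = fc support_carrier
  have inner: "(\<Oplus>x\<in>S. f x \<otimes> (a y \<otimes> b (inv\<^bsub>G\<^esub> y \<otimes>\<^bsub>G\<^esub> x)))
      = pairing (\<lambda>z. f (y \<otimes>\<^bsub>G\<^esub> z)) b \<otimes> a y" if y: "y \<in> support a" for y
  proof -
    have yc: "y \<in> carrier G" using y by simp
    have "(\<Oplus>x\<in>S. f x \<otimes> (a y \<otimes> b (inv\<^bsub>G\<^esub> y \<otimes>\<^bsub>G\<^esub> x)))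
        = (\<Oplus>x\<in>(\<lambda>z. y \<otimes>\<^bsub>G\<^esub> z) ` support b. f x \<otimes> (a y \<otimes> b (inv\<^bsub>G\<^esub> y \<otimes>\<^bsub>G\<^esub> x)))"
    proof (rule add.finprod_mono_neutral_cong_right)
      show "(\<lambda>z. y \<otimes>\<^bsub>G\<^esub> z) ` support b \<subseteq> S" using y by (auto simp: S_def)
      show "f x \<otimes> (a y \<otimes> b (inv\<^bsub>G\<^esub> y \<otimes>\<^bsub>G\<^esub> x)) = \<zero>" if "x \<in> S - (\<lambda>z. y \<otimes>\<^bsub>G\<^esub> z) ` support b" for x
        using outside[OF y, of x] that S a by auto
    qed (use S a b in auto)
    also have "\<dots> = (\<Oplus>z\<in>support b. f (y \<otimes>\<^bsub>G\<^esub> z) \<otimes> (a y \<otimes> b (inv\<^bsub>G\<^esub> y \<otimes>\<^bsub>G\<^esub> (y \<otimes>\<^bsub>G\<^esub> z))))"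
      using a b yc by (intro finsum_reindex) (auto intro!: inj_onI)
    also have "\<dots> = (\<Oplus>z\<in>support b. f (y \<otimes>\<^bsub>G\<^esub> z) \<otimes> b z \<otimes> a y)"
      using a b yc by (intro finsum_cong') (auto simp: m_ac simp flip: G.m_assoc)
    also have "\<dots> = pairing (\<lambda>z. f (y \<otimes>\<^bsub>G\<^esub> z)) b \<otimes> a y"
      unfolding pairing_def using a b yc by (intro finsum_ldistr[symmetric]) auto
    finally show ?thesis .
  qed
  have "pairing f (a \<otimes>\<^bsub>RG\<^esub> b) = (\<Oplus>x\<in>S. f x \<otimes> (a \<otimes>\<^bsub>RG\<^esub> b) x)"
    using closed S supp f by (intro pairing_superset)
  also have "\<dots> = (\<Oplus>x\<in>S. \<Oplus>y\<in>support a. f x \<otimes> (a y \<otimes> b (inv\<^bsub>G\<^esub> y \<otimes>\<^bsub>G\<^esub> x)))"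
  proof (rule finsum_cong')
    fix x assume "x \<in> S"
    then have "x \<in> carrier G" using S by blast
    then show "f x \<otimes> (a \<otimes>\<^bsub>RG\<^esub> b) x = (\<Oplus>y\<in>support a. f x \<otimes> (a y \<otimes> b (inv\<^bsub>G\<^esub> y \<otimes>\<^bsub>G\<^esub> x)))"
      using a b by (auto simp: mult_RG intro!: finsum_rdistr)
  qed (use S a b in \<open>auto intro!: finsum_closed\<close>)
  also have "\<dots> = (\<Oplus>y\<in>support a. \<Oplus>x\<in>S. f x \<otimes> (a y \<otimes> b (inv\<^bsub>G\<^esub> y \<otimes>\<^bsub>G\<^esub> x)))"
    using S a b by (intro finsum_swap) auto
  also have "\<dots> = (\<Oplus>y\<in>support a. pairing (\<lambda>z. f (y \<otimes>\<^bsub>G\<^esub> z)) b \<otimes> a y)"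
    using inner a b by (intro finsum_cong') auto
  also have "\<dots> = pairing (\<lambda>y. pairing (\<lambda>z. f (y \<otimes>\<^bsub>G\<^esub> z)) b) a"
    by (simp add: pairing_def[of _ a])
  finally show "pairing f (a \<otimes>\<^bsub>RG\<^esub> b) = pairing (\<lambda>y. pairing (\<lambda>z. f (y \<otimes>\<^bsub>G\<^esub> z)) b) a" .
qed

lemma pairing_swap:
  assumes "a \<in> carrier RG" "b \<in> carrier RG"
    "\<And>x y. x \<in> carrier G \<Longrightarrow> y \<in> carrier G \<Longrightarrow> F x y \<in> carrier R"
  shows "pairing (\<lambda>x. pairing (\<lambda>y. F x y) b) a = pairing (\<lambda>y. pairing (\<lambda>x. F x y) a) b"
proof -
  note [simp] = support_carrier assms RG_coeff[OF assms(1)] RG_coeff[OF assms(2)]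
  have "pairing (\<lambda>x. pairing (\<lambda>y. F x y) b) a
      = (\<Oplus>x\<in>support a. \<Oplus>y\<in>support b. F x y \<otimes> b y \<otimes> a x)"
    unfolding pairing_def by (intro finsum_cong' finsum_ldistr) (auto intro!: finsum_closed)
  also have "\<dots> = (\<Oplus>y\<in>support b. \<Oplus>x\<in>support a. F x y \<otimes> b y \<otimes> a x)"
    by (intro finsum_swap) auto
  also have "\<dots> = (\<Oplus>y\<in>support b. \<Oplus>x\<in>support a. F x y \<otimes> a x \<otimes> b y)"
    by (intro finsum_cong') (auto intro!: finsum_closed simp: m_ac)
  also have "\<dots> = pairing (\<lambda>y. pairing (\<lambda>x. F x y) a) b"
    unfolding pairing_def
    by (intro finsum_cong' finsum_ldistr[symmetric]) (auto intro!: finsum_closed)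
  finally show ?thesis .
qed

text \<open>A function \<open>f\<close> with \<open>f (x y) = f (y x)\<close>, that is, a class function, extends to a trace on the
  group ring; commutativity of \<open>R\<close> enters through \<open>pairing_swap\<close>.\<close>

lemma pairing_mult_comm:
  assumes "a \<in> carrier RG" "b \<in> carrier RG" "f \<in> carrier G \<rightarrow> carrier R"
    and trace: "\<And>x y. x \<in> carrier G \<Longrightarrow> y \<in> carrier G \<Longrightarrow> f (x \<otimes>\<^bsub>G\<^esub> y) = f (y \<otimes>\<^bsub>G\<^esub> x)"
  shows "pairing f (a \<otimes>\<^bsub>RG\<^esub> b) = pairing f (b \<otimes>\<^bsub>RG\<^esub> a)"
proof -
  note [simp] = assms(1-2) funcset_mem[OF assms(3)]
  have "pairing f (a \<otimes>\<^bsub>RG\<^esub> b) = pairing (\<lambda>z. pairing (\<lambda>y. f (y \<otimes>\<^bsub>G\<^esub> z)) a) b"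
    using assms(1-3) by (simp add: pairing_mult(2)) (intro pairing_swap; simp)
  also have "\<dots> = pairing (\<lambda>z. pairing (\<lambda>y. f (z \<otimes>\<^bsub>G\<^esub> y)) a) b"
    by (intro pairing_cong trace) auto
  also have "\<dots> = pairing f (b \<otimes>\<^bsub>RG\<^esub> a)"
    using assms(1-3) by (simp add: pairing_mult(2))
  finally show ?thesis .
qed

lemma elt_mult:
  assumes "g \<in> carrier G" "h \<in> carrier G"
  shows "group_ring_elt R g \<otimes>\<^bsub>RG\<^esub> group_ring_elt R h = group_ring_elt R (g \<otimes>\<^bsub>G\<^esub> h)"
proof (rule RG_eqI)
  fix f assume f: "f \<in> carrier G \<rightarrow> carrier R"
  show "pairing f (group_ring_elt R g \<otimes>\<^bsub>RG\<^esub> group_ring_elt R h)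
      = pairing f (group_ring_elt R (g \<otimes>\<^bsub>G\<^esub> h))"
    using assms f by (simp add: pairing_mult(2) elt_closed pairing_elt(2) Pi_iff)
qed (use assms in \<open>simp_all add: elt_closed mult_closed\<close>)

lemma one_RG: "\<one>\<^bsub>RG\<^esub> = group_ring_elt R \<one>\<^bsub>G\<^esub>"
  by (simp add: group_ring_def group_ring_elt_def)

lemma monoid_RG: "monoid RG"
proof
  fix a b c assume abc: "a \<in> carrier RG" "b \<in> carrier RG" "c \<in> carrier RG"
  show "a \<otimes>\<^bsub>RG\<^esub> b \<in> carrier RG" using abc by (intro mult_closed)
  show "a \<otimes>\<^bsub>RG\<^esub> b \<otimes>\<^bsub>RG\<^esub> c = a \<otimes>\<^bsub>RG\<^esub> (b \<otimes>\<^bsub>RG\<^esub> c)"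
  proof (rule RG_eqI)
    fix f assume f: "f \<in> carrier G \<rightarrow> carrier R"
    note [simp] = abc mult_closed funcset_mem[OF f]
    have "pairing f (a \<otimes>\<^bsub>RG\<^esub> b \<otimes>\<^bsub>RG\<^esub> c)
        = pairing (\<lambda>x. pairing (\<lambda>y. pairing (\<lambda>z. f (x \<otimes>\<^bsub>G\<^esub> y \<otimes>\<^bsub>G\<^esub> z)) c) b) a"
      using f by (simp add: pairing_mult(2))
    also have "\<dots> = pairing (\<lambda>x. pairing (\<lambda>y. pairing (\<lambda>z. f (x \<otimes>\<^bsub>G\<^esub> (y \<otimes>\<^bsub>G\<^esub> z))) c) b) a"
      by (intro pairing_cong) (auto simp: G.m_assoc)
    also have "\<dots> = pairing (\<lambda>x. pairing (\<lambda>w. f (x \<otimes>\<^bsub>G\<^esub> w)) (b \<otimes>\<^bsub>RG\<^esub> c)) a"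
      by (intro pairing_cong) (auto simp: pairing_mult(2))
    also have "\<dots> = pairing f (a \<otimes>\<^bsub>RG\<^esub> (b \<otimes>\<^bsub>RG\<^esub> c))"
      using f by (simp add: pairing_mult(2))
    finally show "pairing f (a \<otimes>\<^bsub>RG\<^esub> b \<otimes>\<^bsub>RG\<^esub> c) = pairing f (a \<otimes>\<^bsub>RG\<^esub> (b \<otimes>\<^bsub>RG\<^esub> c))" .
  qed (use abc in \<open>simp_all add: mult_closed\<close>)
next
  show one: "\<one>\<^bsub>RG\<^esub> \<in> carrier RG" by (simp add: one_RG elt_closed)
  fix a assume a: "a \<in> carrier RG"
  show "\<one>\<^bsub>RG\<^esub> \<otimes>\<^bsub>RG\<^esub> a = a"
  proof (rule RG_eqI)
    fix f assume f: "f \<in> carrier G \<rightarrow> carrier R"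
    note [simp] = a funcset_mem[OF f]
    have "pairing f (\<one>\<^bsub>RG\<^esub> \<otimes>\<^bsub>RG\<^esub> a) = pairing (\<lambda>z. f (\<one>\<^bsub>G\<^esub> \<otimes>\<^bsub>G\<^esub> z)) a"
      using f by (simp add: pairing_mult(2) one_RG elt_closed pairing_elt(2) Pi_iff)
    also have "\<dots> = pairing f a" using f by (intro pairing_cong) auto
    finally show "pairing f (\<one>\<^bsub>RG\<^esub> \<otimes>\<^bsub>RG\<^esub> a) = pairing f a" .
  qed (use a one in \<open>simp_all add: mult_closed\<close>)
  show "a \<otimes>\<^bsub>RG\<^esub> \<one>\<^bsub>RG\<^esub> = a"
  proof (rule RG_eqI)
    fix f assume f: "f \<in> carrier G \<rightarrow> carrier R"
    note [simp] = a funcset_mem[OF f]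
    have "pairing f (a \<otimes>\<^bsub>RG\<^esub> \<one>\<^bsub>RG\<^esub>) = pairing (\<lambda>y. pairing (\<lambda>z. f (y \<otimes>\<^bsub>G\<^esub> z)) \<one>\<^bsub>RG\<^esub>) a"
      using f one by (simp add: pairing_mult(2))
    also have "\<dots> = pairing f a"
      using f by (intro pairing_cong) (auto simp: one_RG pairing_elt(2))
    finally show "pairing f (a \<otimes>\<^bsub>RG\<^esub> \<one>\<^bsub>RG\<^esub>) = pairing f a" .
  qed (use a one in \<open>simp_all add: mult_closed\<close>)
qed

lemma group_units: "group (group_ring_units R G)"
  unfolding group_ring_units_def using monoid.units_group[OF monoid_RG] .

lemma elt_hom_units: "group_ring_elt R \<in> hom G (group_ring_units R G)"
proof (rule homI)
  fix g assume g: "g \<in> carrier G"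
  have "group_ring_elt R (inv\<^bsub>G\<^esub> g) \<otimes>\<^bsub>RG\<^esub> group_ring_elt R g = \<one>\<^bsub>RG\<^esub>"
    "group_ring_elt R g \<otimes>\<^bsub>RG\<^esub> group_ring_elt R (inv\<^bsub>G\<^esub> g) = \<one>\<^bsub>RG\<^esub>"
    using g by (simp_all add: elt_mult one_RG)
  then show "group_ring_elt R g \<in> carrier (group_ring_units R G)"
    using g elt_closed G.inv_closed
    unfolding group_ring_units_def units_of_carrier Units_def by blast
qed (simp add: group_ring_units_def units_of_mult elt_mult)

lemma inj_elt: "\<one> \<noteq> \<zero> \<Longrightarrow> inj_on (group_ring_elt R) S"
  unfolding group_ring_elt_def by (intro inj_onI) (metis (full_types))

text \<open>The trace given by the indicator function of the conjugacy class of \<open>x\<close> agrees on the two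
  products, and its value on a group element tells whether this element is in the class.\<close>

lemma conjugate_if_products_in_both_orders:
  assumes nontrivial: "\<one> \<noteq> \<zero>" and x: "x \<in> carrier G" and y: "y \<in> carrier G"
    and a: "a \<in> carrier RG" and b: "b \<in> carrier RG"
    and xy: "group_ring_elt R x = b \<otimes>\<^bsub>RG\<^esub> a" "group_ring_elt R y = a \<otimes>\<^bsub>RG\<^esub> b"
  shows "\<exists>g\<in>carrier G. y = g \<otimes>\<^bsub>G\<^esub> x \<otimes>\<^bsub>G\<^esub> inv\<^bsub>G\<^esub> g"
proof -
  define cls where "cls = {z. \<exists>g\<in>carrier G. z = g \<otimes>\<^bsub>G\<^esub> x \<otimes>\<^bsub>G\<^esub> inv\<^bsub>G\<^esub> g}"
  define f where "f = (\<lambda>z. if z \<in> cls then \<one> else \<zero>)"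
  have f: "f \<in> carrier G \<rightarrow> carrier R" by (simp add: f_def)
  have conj_cls: "k \<otimes>\<^bsub>G\<^esub> z \<otimes>\<^bsub>G\<^esub> inv\<^bsub>G\<^esub> k \<in> cls" if "k \<in> carrier G" "z \<in> cls" for k z
    using that G.conj_conj[symmetric] x unfolding cls_def by blast
  have "w \<otimes>\<^bsub>G\<^esub> z \<in> cls" if wz: "w \<in> carrier G" "z \<in> carrier G" "z \<otimes>\<^bsub>G\<^esub> w \<in> cls" for w z
  proof -
    have "w \<otimes>\<^bsub>G\<^esub> (z \<otimes>\<^bsub>G\<^esub> w) \<otimes>\<^bsub>G\<^esub> inv\<^bsub>G\<^esub> w = w \<otimes>\<^bsub>G\<^esub> z"
      using wz by (simp add: G.m_assoc)
    then show ?thesis using conj_cls[OF wz(1,3)] by simp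
  qed
  then have "f (w \<otimes>\<^bsub>G\<^esub> z) = f (z \<otimes>\<^bsub>G\<^esub> w)" if "w \<in> carrier G" "z \<in> carrier G" for w z
    using that by (auto simp: f_def)
  then have "f y = f x"
    using pairing_mult_comm[OF a b f] pairing_elt(2)[OF x f] pairing_elt(2)[OF y f] xy by simp
  moreover have "x \<in> cls" unfolding cls_def using x by (auto intro!: bexI[of _ "\<one>\<^bsub>G\<^esub>"])
  ultimately have "y \<in> cls" using nontrivial by (auto simp: f_def split: if_splits)
  then show ?thesis by (simp add: cls_def)
qed

end

section \<open>The normalizer property for dihedral groups\<close>

theorem corollary12:
  fixes G :: "('g, 'n) monoid_scheme" and R :: "('r, 'm) ring_scheme" and H :: "'g set"
  assumes "dihedral_group G"
    and "cring R" and "\<one>\<^bsub>R\<^esub> \<noteq> \<zero>\<^bsub>R\<^esub>"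
    and "subgroup H G"
  shows "normalizer (group_ring_units R G) (group_ring_elt R ` H) =
    (group_ring_elt R ` normalizer G H) <#>\<^bsub>group_ring_units R G\<^esub>
      centralizer (group_ring_units R G) (group_ring_elt R ` H)"
proof -
  have "group G" using assms(1) by (simp add: dihedral_group_def)
  then interpret group_ring_context R G
    using assms(2) by (simp add: group_ring_context_def)
  let ?U = "group_ring_units R G" and ?e = "group_ring_elt R"
  interpret U: group ?U by (rule group_units)
  interpret RG: monoid RG by (rule monoid_RG)
  interpret e: group_hom G ?U ?e using elt_hom_units by unfold_locales
  obtain A s where A: "subgroup A G" "s \<in> carrier G"
    "\<And>a b. a \<in> A \<Longrightarrow> b \<in> A \<Longrightarrow> a \<otimes>\<^bsub>G\<^esub> b = b \<otimes>\<^bsub>G\<^esub> a"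
    "\<And>a. a \<in> A \<Longrightarrow> s \<otimes>\<^bsub>G\<^esub> a \<otimes>\<^bsub>G\<^esub> inv\<^bsub>G\<^esub> s = inv\<^bsub>G\<^esub> a"
    "\<And>x. x \<in> carrier G \<Longrightarrow> x \<in> A \<or> (\<exists>a\<in>A. x = a \<otimes>\<^bsub>G\<^esub> s)"
    using dihedral_group_decomposition[OF assms(1)] by metis
  have H: "H \<subseteq> carrier G" using assms(4) by (rule subgroup.subset)
  have Hc: "h \<in> carrier G" if "h \<in> H" for h using that H by blast
  have eH: "?e ` H \<subseteq> carrier ?U" using H by auto
  show ?thesis
  proof (rule normalizer_image_eq_mult_centralizer[OF \<open>group G\<close> group_units elt_hom_units
        inj_elt[OF assms(3)] H])
    fix u assume "u \<in> normalizer ?U (?e ` H)"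
    then have u: "u \<in> carrier ?U"
      and img: "(\<lambda>x. u \<otimes>\<^bsub>?U\<^esub> x \<otimes>\<^bsub>?U\<^esub> inv\<^bsub>?U\<^esub> u) ` ?e ` H = ?e ` H"
      by (auto simp: U.normalizer_eq[OF eH])
    have "\<exists>k\<in>H. u \<otimes>\<^bsub>?U\<^esub> ?e h \<otimes>\<^bsub>?U\<^esub> inv\<^bsub>?U\<^esub> u = ?e k" if "h \<in> H" for h
      using img that by blast
    then obtain \<phi> where \<phi>H: "\<And>h. h \<in> H \<Longrightarrow> \<phi> h \<in> H"
      and \<phi>: "\<And>h. h \<in> H \<Longrightarrow> ?e (\<phi> h) = u \<otimes>\<^bsub>?U\<^esub> ?e h \<otimes>\<^bsub>?U\<^esub> inv\<^bsub>?U\<^esub> u"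
      by metis
    have "\<exists>g\<in>carrier G. \<forall>h\<in>H. \<phi> h = g \<otimes>\<^bsub>G\<^esub> h \<otimes>\<^bsub>G\<^esub> inv\<^bsub>G\<^esub> g"
    proof (rule G.class_preserving_imp_conjugation[OF A(1,3,2,4,5) assms(4)])
      fix h k assume hk: "h \<in> H" "k \<in> H"
      then have "?e (\<phi> (h \<otimes>\<^bsub>G\<^esub> k)) = ?e (\<phi> h) \<otimes>\<^bsub>?U\<^esub> ?e (\<phi> k)"
        using \<phi> subgroup.m_closed[OF assms(4)] U.conj_mult[OF u] Hc by simp
      also have "\<dots> = ?e (\<phi> h \<otimes>\<^bsub>G\<^esub> \<phi> k)"
        using hk \<phi>H Hc by simp
      finally show "\<phi> (h \<otimes>\<^bsub>G\<^esub> k) = \<phi> h \<otimes>\<^bsub>G\<^esub> \<phi> k"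
        using inj_elt[OF assms(3), of UNIV] by (rule injD[rotated])
    next
      fix h assume h: "h \<in> H"
      let ?a = "u \<otimes>\<^bsub>?U\<^esub> ?e h" and ?v = "inv\<^bsub>?U\<^esub> u"
      have U_RG: "carrier ?U \<subseteq> carrier RG" "mult ?U = mult RG"
        by (auto simp: group_ring_units_def units_of_carrier units_of_mult RG.Units_closed)
      \<comment> \<open>The factors \<open>u h\<close> and \<open>u\<inverse>\<close> give \<open>\<phi> h\<close> in one order and \<open>h\<close> in the other.\<close>
      show "\<exists>g\<in>carrier G. \<phi> h = g \<otimes>\<^bsub>G\<^esub> h \<otimes>\<^bsub>G\<^esub> inv\<^bsub>G\<^esub> g"
      proof (rule conjugate_if_products_in_both_orders[OF assms(3)])
        show "?a \<in> carrier RG" "?v \<in> carrier RG"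
          using u h Hc U_RG(1) by auto
        have "?e h = ?v \<otimes>\<^bsub>?U\<^esub> ?a"
          using u h Hc by (simp flip: U.m_assoc)
        then show "?e h = ?v \<otimes>\<^bsub>RG\<^esub> ?a" by (simp add: U_RG(2))
        show "?e (\<phi> h) = ?a \<otimes>\<^bsub>RG\<^esub> ?v"
          using \<phi>[OF h] by (simp add: U_RG(2))
      qed (use h \<phi>H Hc in auto)
    qed
    then show "\<exists>g\<in>carrier G. \<forall>h\<in>H. u \<otimes>\<^bsub>?U\<^esub> ?e h \<otimes>\<^bsub>?U\<^esub> inv\<^bsub>?U\<^esub> u = ?e (g \<otimes>\<^bsub>G\<^esub> h \<otimes>\<^bsub>G\<^esub> inv\<^bsub>G\<^esub> g)"
      using \<phi> by metis
  qed
qed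

end
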